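(* Let $n>2$, let $P_1,\ldots,P_{n+2}$ be generic points of $\mathbb{P}^n$ and let $\Lambda\subset\mathbb{P}^n$ be a generic codimension two linear space, with defining homogeneous ideals $I_{P_1},\ldots,I_{P_{n+2}},I_\Lambda$ respectively. Let $X\subset\mathbb{P}^n$ be the scheme with ideal $$I_X=(I_{P_1})^2\cap\cdots\cap(I_{P_{n+2}})^2\cap(I_\Lambda)^2,$$ and set $$h=(n+2)(n+1)+\binom{n+2}{4}+2\binom{n+1}{3}.$$ Then $X$ does not impose the expected number $h$ of conditions on degree $4$ hypersurfaces; precisely, $$H(X,4)\leq h-1.$$
   Context: The base field is $\mathbb{C}$. For a closed subscheme $X\subset\mathbb{P}^n$ with homogeneous ideal $I_X\subset S=\mathbb{C}[x_0,\ldots,x_n]$, its Hilbert function in degree $d$ is $H(X,d)=\dim_{\mathbb{C}}(S/I_X)_d$. The number $h$ is the expected value of $H(X,4)$ given by counting conditions: $n+1$ conditions for each of the $n+2$ double points, and $\binom{n+2}{4}+2\binom{n+1}{3}$ conditions for the double codimension two linear space. "Generic" means that the conclusion holds for all $(\Lambda,P_1,\ldots,P_{n+2})$ in some non-empty Zariski open subset of $G(n-2,\mathbb{P}^n)\times(\mathbb{P}^n)^{n+2}$, where $G(n-2,\mathbb{P}^n)$ is the Grassmannian of codimension two linear subspaces of $\mathbb{P}^n$. *)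

theory Defs
  imports
    "HOL-Analysis.Cartesian_Space"
    "HOL-Library.Poly_Mapping"
    "HOL-Algebra.Ideal_Product"
    "HOL-Algebra.QuotRing"
    "HOL-Algebra.Embedded_Algebras"
    "HOL-Algebra.Algebraic_Closure_Type"
begin

text \<open>
  Polynomials over the complex numbers in the variables \<^typ>\<open>'v\<close>: finitely supported functions
  from exponent vectors to coefficients. With \<open>CARD('n) = n + 1\<close>, the type \<open>'n cpoly\<close> is the
  homogeneous coordinate ring of projective \<open>n\<close>-space.
\<close>

type_synonym 'v cpoly = "('v \<Rightarrow>\<^sub>0 nat) \<Rightarrow>\<^sub>0 complex"

abbreviation cpoly_ring :: "('v cpoly) ring" where
  "cpoly_ring \<equiv> ring_of_type_algebra"

definition eval_cpoly :: "'v::finite cpoly \<Rightarrow> ('v \<Rightarrow> complex) \<Rightarrow> complex" where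
  "eval_cpoly f x = (\<Sum>m\<in>Poly_Mapping.keys f.
     Poly_Mapping.lookup f m * (\<Prod>v\<in>UNIV. x v ^ Poly_Mapping.lookup m v))"

text \<open>Homogeneity of degree \<open>d\<close> in a block \<open>B\<close> of variables, the others being treated as scalars.
  The zero polynomial is homogeneous of every degree.\<close>

definition homogeneous_in :: "'v::finite set \<Rightarrow> nat \<Rightarrow> 'v cpoly \<Rightarrow> bool" where
  "homogeneous_in B d f \<longleftrightarrow>
     (\<forall>m\<in>Poly_Mapping.keys f. (\<Sum>v\<in>B. Poly_Mapping.lookup m v) = d)"

abbreviation homogeneous :: "nat \<Rightarrow> 'v::finite cpoly \<Rightarrow> bool" where
  "homogeneous \<equiv> homogeneous_in UNIV"

text \<open>
  \<open>H(I, d)\<close>, the dimension of \<open>(S/I)\<^sub>d\<close> for a homogeneous ideal \<open>I\<close> of \<open>S\<close>. Inside the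
  ring \<open>S/I\<close>, the scalars are the classes of the constants and \<open>(S/I)\<^sub>d\<close> is the set
  of classes of forms of degree \<open>d\<close>.
\<close>

definition hilbert_function :: "'v::finite cpoly set \<Rightarrow> nat \<Rightarrow> nat" where
  "hilbert_function I d =
     ring.dim (cpoly_ring Quot I)
       {I +>\<^bsub>cpoly_ring\<^esub> Poly_Mapping.single 0 c | c. True}
       {I +>\<^bsub>cpoly_ring\<^esub> f | f. homogeneous d f}"

text \<open>
  Linear subspaces of projective \<open>n\<close>-space are represented by the corresponding vector subspaces
  of \<^typ>\<open>complex ^ 'n\<close>, where \<open>CARD('n) = n + 1\<close>; in particular points are lines
  through the origin.
\<close>

definition projective_points :: "(complex ^ 'n::finite) set set" where
  "projective_points = {L. vec.subspace L \<and> vec.dim L = 1}"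

definition codim_two_spaces :: "(complex ^ 'n::finite) set set" where
  "codim_two_spaces = {L. vec.subspace L \<and> vec.dim L + 2 = CARD('n)}"

text \<open>The polynomials that vanish at all homogeneous coordinate vectors of all points. As the field
  is infinite, this is a homogeneous ideal.\<close>

definition vanishing_ideal :: "(complex ^ 'n::finite) set \<Rightarrow> 'n cpoly set" where
  "vanishing_ideal L = {f. \<forall>x\<in>L. eval_cpoly f (\<lambda>i. x $ i) = 0}"

definition square_ideal :: "'v cpoly set \<Rightarrow> 'v cpoly set" where
  "square_ideal I = ideal_prod cpoly_ring I I"

definition double_scheme_ideal ::
    "(complex ^ 'n::finite) set \<Rightarrow> ('p \<Rightarrow> (complex ^ 'n) set) \<Rightarrow> 'n cpoly set" where
  "double_scheme_ideal \<Lambda> P =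
     (\<Inter>k. square_ideal (vanishing_ideal (P k))) \<inter> square_ideal (vanishing_ideal \<Lambda>)"

text \<open>
  The Zariski topology on the product of the Grassmannian of codimension two subspaces and of
  copies of projective space indexed by \<^typ>\<open>'p\<close>. If \<open>\<Lambda>\<close> is cut out by the linear forms with
  coefficient vectors \<open>\<alpha>\<close> and \<open>\<beta>\<close>, its Pluecker coordinates are taken to be the
  minors \<open>\<alpha>\<^sub>i \<beta>\<^sub>j - \<alpha>\<^sub>j \<beta>\<^sub>i\<close>; up to a common factor and signs these are the
  maximal minors of a basis of \<open>\<Lambda>\<close>, indexed by the complementary sets of columns. Closed sets are
  the common zero loci of polynomials in these and in the coordinates of the points which
  are homogeneous in each block separately.
\<close>

type_synonym ('n, 'p) config = "(complex ^ 'n) set \<times> ('p \<Rightarrow> (complex ^ 'n) set)"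

type_synonym ('n, 'p) config_coord = "('n \<times> 'n) + ('p \<times> 'n)"

definition config_space :: "('n::finite, 'p::finite) config set" where
  "config_space = codim_two_spaces \<times> {P. \<forall>k. P k \<in> projective_points}"

definition multihomogeneous :: "('n::finite, 'p::finite) config_coord cpoly \<Rightarrow> bool" where
  "multihomogeneous F \<longleftrightarrow>
     (\<exists>d. homogeneous_in (Inl ` UNIV) d F) \<and>
     (\<forall>k. \<exists>d. homogeneous_in (Inr ` ({k} \<times> UNIV)) d F)"

fun config_coords ::
    "complex ^ 'n \<Rightarrow> complex ^ 'n \<Rightarrow> ('p \<Rightarrow> complex ^ 'n) \<Rightarrow> ('n, 'p) config_coord \<Rightarrow> complex" where
  "config_coords \<alpha> \<beta> v (Inl (i, j)) = \<alpha> $ i * \<beta> $ j - \<alpha> $ j * \<beta> $ i"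
| "config_coords \<alpha> \<beta> v (Inr (k, i)) = v k $ i"

definition zero_locus ::
    "('n::finite, 'p::finite) config_coord cpoly set \<Rightarrow> ('n, 'p) config set" where
  "zero_locus \<F> = {(\<Lambda>, P) \<in> config_space. \<forall>F\<in>\<F>. \<forall>\<alpha> \<beta> v.
     \<Lambda> = {x. scalar_product \<alpha> x = 0 \<and> scalar_product \<beta> x = 0} \<longrightarrow>
     (\<forall>k. v k \<in> P k - {0}) \<longrightarrow> eval_cpoly F (config_coords \<alpha> \<beta> v) = 0}"

definition zariski_open :: "('n::finite, 'p::finite) config set \<Rightarrow> bool" where
  "zariski_open U \<longleftrightarrow>
     (\<exists>\<F>. (\<forall>F\<in>\<F>. multihomogeneous F) \<and> U = config_space - zero_locus \<F>)"

end

theory Submission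
  imports Defs "HOL-Analysis.Determinants"
begin

text \<open>
  There are \<open>n + 4 choose 4\<close> quartic monomials, and subtracting \<open>h - 1\<close> leaves
  exactly \<open>n choose 2\<close>. So the claim is that the ideal of \<open>X\<close> contains \<open>n choose 2\<close> linearly
  independent quartics. This is the number of unordered pairs, with repetition, of \<open>n - 1\<close>
  objects. The objects are quadrics: those containing \<open>\<Lambda>\<close> form a space of dimension
  \<open>2 * n + 1\<close>, and passing through \<open>n + 2\<close> points leaves dimension \<open>n - 1\<close>. The product of two
  quadrics that contain \<open>\<Lambda>\<close> and all points belongs to the square of each of the ideals, hence to
  the ideal of \<open>X\<close>. What has to be seen is that for generic data the pairwise products of
  \<open>n - 1\<close> such quadrics are independent.

  Among the hyperplanes through \<open>\<Lambda>\<close>, let \<open>\<beta> = 0\<close> be the one through a distinguished point \<open>w\<close>, and let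
  \<open>\<alpha> = 0\<close> be another one. If \<open>\<beta>\<close> is nonzero at the other points and these form a basis, then for
  every linear form \<open>m\<close> with \<open>m w = 0\<close> there is a unique linear form \<open>l\<close> such that the quadric
  \<open>\<alpha> m + \<beta> l\<close> contains all points. On the hyperplane \<open>\<beta> = 0\<close> this quadric is \<open>\<alpha> m\<close>, so a relation
  between products of quadrics restricts to \<open>\<alpha>\<^sup>2\<close> times a relation between products of
  the forms \<open>m\<close>. Choosing the \<open>m\<close> independent modulo \<open>\<beta>\<close> excludes this
  (\<open>exists_quadrics\<close> and \<open>pairwise_products_independent\<close>).

  The lemma \<open>hilbert_function_le\<close> converts independent forms in an ideal into an upper bound for
  the Hilbert function. The open set is the complement of the hypersurface given by
  \<open>position_poly\<close>, which expresses the two conditions above on the points and the pencil.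
\<close>

section \<open>Evaluation and homogeneity of polynomials\<close>

lemma cpoly_eq_sum_monomials:
  "f = (\<Sum>m\<in>Poly_Mapping.keys f. Poly_Mapping.single m (Poly_Mapping.lookup f m))"
  by (rule poly_mapping_eqI)
    (auto simp: lookup_sum lookup_single when_def in_keys_iff)

lemma eval_cpoly_add: "eval_cpoly (f + g) x = eval_cpoly f x + eval_cpoly g x"
  unfolding eval_cpoly_def
  by (rule setsum_keys_plus_distrib) (auto simp: distrib_right)

lemma eval_cpoly_zero [simp]: "eval_cpoly 0 x = 0"
  by (simp add: eval_cpoly_def)

lemma eval_cpoly_sum: "eval_cpoly (\<Sum>a\<in>A. f a) x = (\<Sum>a\<in>A. eval_cpoly (f a) x)"
  by (induction A rule: infinite_finite_induct) (auto simp: eval_cpoly_add)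

lemma eval_cpoly_single:
  "eval_cpoly (Poly_Mapping.single m c) x = c * (\<Prod>v\<in>UNIV. x v ^ Poly_Mapping.lookup m v)"
  by (simp add: eval_cpoly_def)

lemma eval_cpoly_mult: "eval_cpoly (f * g) x = eval_cpoly f x * eval_cpoly g x"
proof -
  have monomials: "eval_cpoly (Poly_Mapping.single k a * Poly_Mapping.single l b) x =
      eval_cpoly (Poly_Mapping.single k a) x * eval_cpoly (Poly_Mapping.single l b) x" for k l a b
    by (simp add: mult_single eval_cpoly_single lookup_add power_add prod.distrib)
  have "f * g = (\<Sum>k\<in>Poly_Mapping.keys f. \<Sum>l\<in>Poly_Mapping.keys g.
      Poly_Mapping.single k (Poly_Mapping.lookup f k) *
      Poly_Mapping.single l (Poly_Mapping.lookup g l))"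
    by (subst cpoly_eq_sum_monomials[of f], subst cpoly_eq_sum_monomials[of g])
      (rule sum_product)
  then have "eval_cpoly (f * g) x = (\<Sum>k\<in>Poly_Mapping.keys f. \<Sum>l\<in>Poly_Mapping.keys g.
      eval_cpoly (Poly_Mapping.single k (Poly_Mapping.lookup f k)) x *
      eval_cpoly (Poly_Mapping.single l (Poly_Mapping.lookup g l)) x)"
    by (simp add: eval_cpoly_sum monomials)
  also have "\<dots> = eval_cpoly (\<Sum>k\<in>Poly_Mapping.keys f. Poly_Mapping.single k (Poly_Mapping.lookup f k)) x *
      eval_cpoly (\<Sum>l\<in>Poly_Mapping.keys g. Poly_Mapping.single l (Poly_Mapping.lookup g l)) x"
    by (simp add: eval_cpoly_sum sum_product)
  finally show ?thesis
    by (simp flip: cpoly_eq_sum_monomials)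
qed

lemma eval_cpoly_const [simp]: "eval_cpoly (Poly_Mapping.single 0 c) x = c"
  by (simp add: eval_cpoly_single)

lemma eval_cpoly_one [simp]: "eval_cpoly 1 x = 1"
  using eval_cpoly_const[of 1 x] by (simp del: eval_cpoly_const)

lemma eval_cpoly_of_int [simp]: "eval_cpoly (of_int k) x = of_int k"
  using eval_cpoly_const[of "of_int k" x] by (simp del: eval_cpoly_const)

lemma eval_cpoly_prod: "eval_cpoly (\<Prod>a\<in>A. f a) x = (\<Prod>a\<in>A. eval_cpoly (f a) x)"
  by (induction A rule: infinite_finite_induct) (auto simp: eval_cpoly_mult)

lemma eval_cpoly_det:
  "eval_cpoly (det (\<chi> i j. M i j)) x = det (\<chi> i j. eval_cpoly (M i j) x)"
  by (simp add: det_def eval_cpoly_sum eval_cpoly_mult eval_cpoly_prod)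

definition var :: "'v \<Rightarrow> 'v cpoly" where
  "var v = Poly_Mapping.single (Poly_Mapping.single v 1) 1"

lemma eval_cpoly_var [simp]: "eval_cpoly (var v) x = x v"
proof -
  have "(\<Prod>w\<in>UNIV. x w ^ Poly_Mapping.lookup (Poly_Mapping.single v 1) w) =
      (\<Prod>w\<in>UNIV. if w = v then x v else 1)"
    by (rule prod.cong) (auto simp: lookup_single when_def)
  then show ?thesis
    by (simp add: var_def eval_cpoly_single)
qed

lemma homogeneous_in_zero: "homogeneous_in B d 0"
  by (simp add: homogeneous_in_def)

lemma homogeneous_in_const: "homogeneous_in B 0 (Poly_Mapping.single 0 c)"
  by (simp add: homogeneous_in_def)

lemma homogeneous_in_one: "homogeneous_in B 0 1"
  by (simp add: homogeneous_in_def)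

lemma homogeneous_in_of_int: "homogeneous_in B 0 (of_int k)"
  using homogeneous_in_const[of B "of_int k"] by simp

lemma homogeneous_in_var: "homogeneous_in B (if v \<in> B then 1 else 0) (var v)"
  by (auto simp: homogeneous_in_def var_def lookup_single when_def)

lemma homogeneous_in_add:
  "homogeneous_in B d f \<Longrightarrow> homogeneous_in B d g \<Longrightarrow> homogeneous_in B d (f + g)"
  using keys_add[of f g] by (auto simp: homogeneous_in_def)

lemma homogeneous_in_sum:
  "(\<And>a. a \<in> A \<Longrightarrow> homogeneous_in B d (f a)) \<Longrightarrow> homogeneous_in B d (\<Sum>a\<in>A. f a)"
  by (induction A rule: infinite_finite_induct) (auto simp: homogeneous_in_zero homogeneous_in_add)

lemma homogeneous_in_mult:
  assumes "homogeneous_in B d f" "homogeneous_in B e g"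
  shows "homogeneous_in B (d + e) (f * g)"
  unfolding homogeneous_in_def
proof
  fix m assume "m \<in> Poly_Mapping.keys (f * g)"
  then obtain k l where "m = k + l" "k \<in> Poly_Mapping.keys f" "l \<in> Poly_Mapping.keys g"
    using keys_mult[of f g] by blast
  then show "(\<Sum>v\<in>B. Poly_Mapping.lookup m v) = d + e"
    using assms by (simp add: homogeneous_in_def lookup_add sum.distrib)
qed

lemma homogeneous_in_prod:
  "(\<And>a. a \<in> A \<Longrightarrow> homogeneous_in B (d a) (f a)) \<Longrightarrow>
    homogeneous_in B (\<Sum>a\<in>A. d a) (\<Prod>a\<in>A. f a)"
  by (induction A rule: infinite_finite_induct)
    (auto simp: homogeneous_in_one intro: homogeneous_in_mult)

definition linear_form :: "complex ^ 'n \<Rightarrow> 'n::finite cpoly" where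
  "linear_form c = (\<Sum>i\<in>UNIV. Poly_Mapping.single 0 (c $ i) * var i)"

lemma eval_linear_form [simp]:
  "eval_cpoly (linear_form c) (\<lambda>i. x $ i) = scalar_product c x"
  by (simp add: linear_form_def scalar_product_def eval_cpoly_sum eval_cpoly_mult)

lemma homogeneous_linear_form: "homogeneous 1 (linear_form c)"
  unfolding linear_form_def
proof (rule homogeneous_in_sum)
  fix i :: 'a
  show "homogeneous 1 (Poly_Mapping.single 0 (c $ i) * var i)"
    using homogeneous_in_mult[OF homogeneous_in_const homogeneous_in_var[of UNIV i]] by simp
qed

section \<open>An upper bound for the Hilbert function\<close>

definition scale_cpoly :: "complex \<Rightarrow> 'v cpoly \<Rightarrow> 'v cpoly" where
  "scale_cpoly c f = Poly_Mapping.single 0 c * f"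

interpretation cpoly: vector_space scale_cpoly
  by unfold_locales
    (simp_all add: scale_cpoly_def distrib_left distrib_right single_add mult_single
      flip: mult.assoc)

lemma homogeneous_scale: "homogeneous d f \<Longrightarrow> homogeneous d (scale_cpoly c f)"
  using homogeneous_in_mult[OF homogeneous_in_const] unfolding scale_cpoly_def by fastforce

definition monomials :: "nat \<Rightarrow> 'v::finite cpoly set" where
  "monomials d = (\<lambda>m. Poly_Mapping.single m 1) ` {m. (\<Sum>v\<in>UNIV. Poly_Mapping.lookup m v) = d}"

text \<open>
  A monomial is determined by the list of its exponents, and the lists of naturals with a given
  length and sum have been counted (\<open>card_length_sum_list\<close>).
\<close>

lemma card_monomials:
  "finite (monomials d :: 'v::finite cpoly set)"
  "card (monomials d :: 'v::finite cpoly set) \<le> (CARD('v) + d - 1) choose d"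
proof -
  define M where "M = {m :: 'v \<Rightarrow>\<^sub>0 nat. (\<Sum>v\<in>UNIV. Poly_Mapping.lookup m v) = d}"
  define L where "L = {l::nat list. length l = CARD('v) \<and> sum_list l = d}"
  obtain vs :: "'v list" where vs: "set vs = UNIV" "distinct vs"
    using finite_distinct_list[of "UNIV :: 'v set"] by auto
  define f where "f m = map (Poly_Mapping.lookup m) vs" for m :: "'v \<Rightarrow>\<^sub>0 nat"
  have inj: "inj_on f M"
  proof (rule inj_onI)
    fix k l assume "f k = f l"
    then have "Poly_Mapping.lookup k v = Poly_Mapping.lookup l v" for v
      using vs(1) by (simp add: f_def)
    then show "k = l"
      by (rule poly_mapping_eqI)
  qed
  have "length vs = CARD('v)"
    using distinct_card[OF vs(2)] vs(1) by simp
  then have sub: "f ` M \<subseteq> L"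
    using vs by (auto simp: f_def M_def L_def sum_list_distinct_conv_sum_set)
  have "L \<subseteq> {l. set l \<subseteq> {..d} \<and> length l = CARD('v)}"
    by (auto simp: L_def member_le_sum_list)
  then have fin: "finite L"
    by (rule finite_subset) (rule finite_lists_length_eq[OF finite_atMost])
  have finM: "finite M"
    by (rule finite_imageD[OF finite_subset[OF sub fin] inj])
  have "card L = (CARD('v) + d - 1) choose d"
    unfolding L_def card_length_sum_list by (simp add: add.commute)
  then have "card M \<le> (CARD('v) + d - 1) choose d"
    using card_inj_on_le[OF inj sub fin] by simp
  then show "card (monomials d :: 'v cpoly set) \<le> (CARD('v) + d - 1) choose d"
    unfolding monomials_def M_def[symmetric] using card_image_le[OF finM] le_trans by blast
  show "finite (monomials d :: 'v cpoly set)"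
    unfolding monomials_def M_def[symmetric] by (rule finite_imageI[OF finM])
qed

lemma homogeneous_eq_span_monomials: "{f. homogeneous d f} = cpoly.span (monomials d)"
proof (intro equalityI subsetI)
  fix f :: "'a cpoly" assume f: "f \<in> {f. homogeneous d f}"
  have "(\<Sum>m\<in>Poly_Mapping.keys f. scale_cpoly (Poly_Mapping.lookup f m) (Poly_Mapping.single m 1))
      \<in> cpoly.span (monomials d)"
    using f by (intro cpoly.span_sum cpoly.span_scale cpoly.span_base)
      (auto simp: monomials_def homogeneous_in_def)
  then show "f \<in> cpoly.span (monomials d)"
    by (simp add: scale_cpoly_def mult_single flip: cpoly_eq_sum_monomials)
next
  have "cpoly.span (monomials d) \<subseteq> {f :: 'a cpoly. homogeneous d f}"
  proof (rule cpoly.span_minimal)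
    show "monomials d \<subseteq> {f :: 'a cpoly. homogeneous d f}"
      by (auto simp: monomials_def homogeneous_in_def)
    show "cpoly.subspace {f :: 'a cpoly. homogeneous d f}"
      by (auto intro!: cpoly.subspaceI homogeneous_in_zero homogeneous_in_add homogeneous_scale)
  qed
  then show "f \<in> {f. homogeneous d f}" if "f \<in> cpoly.span (monomials d)" for f :: "'a cpoly"
    using that by blast
qed

lemma cpoly_independent_family:
  assumes fin: "finite J"
    and indep: "\<And>c. (\<Sum>p\<in>J. scale_cpoly (c p) (b p)) = 0 \<Longrightarrow> \<forall>p\<in>J. c p = 0"
  shows "inj_on b J" "cpoly.independent (b ` J)"
proof -
  show inj: "inj_on b J"
  proof (rule inj_onI, rule ccontr)
    fix p q assume pq: "p \<in> J" "q \<in> J" "b p = b q" "p \<noteq> q"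
    let ?c = "\<lambda>r. if r = p then 1 else if r = q then - 1 else 0"
    have "(\<Sum>r\<in>J. scale_cpoly (?c r) (b r)) = (\<Sum>r\<in>{p,q}. scale_cpoly (?c r) (b r))"
      using pq fin by (intro sum.mono_neutral_right) auto
    also have "\<dots> = 0"
      using pq by simp
    finally show False
      using indep[of ?c] pq by auto
  qed
  show "cpoly.independent (b ` J)"
  proof
    assume "cpoly.dependent (b ` J)"
    then obtain u where u: "\<exists>v\<in>b ` J. u v \<noteq> 0" "(\<Sum>v\<in>b ` J. scale_cpoly (u v) v) = 0"
      using cpoly.dependent_finite[of "b ` J"] fin by auto
    then show False
      using indep[of "\<lambda>p. u (b p)"] inj by (auto simp: sum.reindex)
  qed
qed

text \<open>
  The dimension is defined as a definite description, so a bound needs the existence of the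
  dimension as well: discarding the vectors that lie in the span of the later ones leaves a basis.
\<close>

lemma (in ring) dim_Span_le_length:
  assumes K: "subfield K R" and Us: "set Us \<subseteq> carrier R"
  shows "dim K (Span K Us) \<le> length Us"
proof -
  have "\<exists>n\<le>length Us. dimension n K (Span K Us)"
    using Us
  proof (induction Us)
    case Nil
    then show ?case by auto
  next
    case (Cons u Us)
    then obtain n where n: "n \<le> length Us" "dimension n K (Span K Us)"
      by auto
    show ?case
    proof (cases "u \<in> Span K Us")
      case True
      then have "Span K (u # Us) = Span K Us"
        using Span_base_incl[OF K] mono_Span_subset[OF K] Cons.prems
        by (metis insert_subset list.simps(15) subset_antisym)
      then show ?thesis
        using n by (metis le_SucI length_Cons)
    next
      case False
      then show ?thesis
        using n Suc_dim[of u "Span K Us" n K] Cons.prems by auto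
    qed
  qed
  then show ?thesis
    using dimI[OF K] by (auto simp: over_def)
qed

lemma carrier_ring_of_type_algebra [simp]: "carrier ring_of_type_algebra = UNIV"
  by (simp add: ring_of_type_algebra_def)

lemma ring_of_type_algebra_ops [simp]:
  "f \<otimes>\<^bsub>ring_of_type_algebra\<^esub> g = f * g" "f \<oplus>\<^bsub>ring_of_type_algebra\<^esub> g = f + g"
  "\<one>\<^bsub>ring_of_type_algebra\<^esub> = 1" "\<zero>\<^bsub>ring_of_type_algebra\<^esub> = 0"
  by (simp_all add: ring_of_type_algebra_def)

lemma constants_subfield:
  "subfield (range (Poly_Mapping.single 0)) (cpoly_ring :: 'v cpoly ring)"
proof -
  let ?C = "ring_of_type_algebra :: complex ring"
  have C: "field ?C"
    by (rule field_from_type_algebra)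
  have "ring_hom_ring ?C (cpoly_ring :: 'v cpoly ring) (Poly_Mapping.single 0)"
    by (intro ring_hom_ringI2 ring_hom_memI ring_from_type_algebra)
      (auto simp: single_add mult_single)
  from ring_hom_ring.img_is_subfield(2)[OF this field.carrier_is_subfield[OF C]]
  show ?thesis by simp
qed

text \<open>
  The dimension in the quotient ring is computed by spans over a subfield in the sense of rings with
  explicit carriers, whereas the exchange argument takes place in a vector space on a type. In the
  polynomial ring the two notions of span agree.
\<close>

lemma Span_constants:
  "ring.Span (cpoly_ring :: 'v cpoly ring) (range (Poly_Mapping.single 0)) fs = cpoly.span (set fs)"
proof -
  interpret R: ring "cpoly_ring :: 'v cpoly ring"
    by (rule ring_from_type_algebra)
  show ?thesis
  proof (induction fs)
    case Nil
    then show ?case by simp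
  next
    case (Cons g fs)
    have "f \<in> R.line_extension (range (Poly_Mapping.single 0)) g (cpoly.span (set fs)) \<longleftrightarrow>
        f \<in> cpoly.span (set (g # fs))" for f
      by (auto simp: R.line_extension_mem_iff cpoly.span_insert scale_cpoly_def)
        (metis add_diff_cancel_left' diff_add_cancel add.commute)+
    then show ?case
      using Cons by auto
  qed
qed

text \<open>
  Exchange: the independent forms \<open>b p\<close> in the ideal can be completed to a basis of the forms of
  degree \<open>d\<close> by monomials. The classes of these monomials span \<open>(S/I)\<^sub>d\<close>, and \<open>card J\<close> of the
  monomials have not been used.
\<close>

lemma hilbert_function_le:
  fixes I :: "'v::finite cpoly set"
  assumes I: "ideal I cpoly_ring" and proper: "1 \<notin> I"
    and fin: "finite J"
    and b: "\<And>p. p \<in> J \<Longrightarrow> b p \<in> I" "\<And>p. p \<in> J \<Longrightarrow> homogeneous d (b p)"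
    and indep: "\<And>c. (\<Sum>p\<in>J. scale_cpoly (c p) (b p)) = 0 \<Longrightarrow> \<forall>p\<in>J. c p = 0"
  shows "hilbert_function I d + card J \<le> (CARD('v) + d - 1) choose d"
proof -
  let ?R = "cpoly_ring :: 'v cpoly ring" and ?S = "{f. homogeneous d f} :: 'v cpoly set"
  let ?K = "range (Poly_Mapping.single 0) :: 'v cpoly set"
  let ?cls = "\<lambda>f :: 'v cpoly. I +>\<^bsub>?R\<^esub> f"
  interpret I: ideal I ?R by (rule I)
  interpret Q: ring "?R Quot I" by (rule I.quotient_is_ring)
  interpret h: ring_hom_ring ?R "?R Quot I" ?cls by (rule I.rcos_ring_hom_ring)

  let ?B = "b ` J"
  have B: "inj_on b J" "cpoly.independent ?B"
    using cpoly_independent_family[OF fin, of b] indep by blast+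
  have B_sub: "?B \<subseteq> ?S" "?B \<subseteq> I"
    using b by auto
  obtain E where E: "?B \<subseteq> E" "E \<subseteq> ?B \<union> monomials d" "cpoly.independent E"
    "?B \<union> monomials d \<subseteq> cpoly.span E"
    using cpoly.maximal_independent_subset_extend[OF Un_upper1 B(2)] by metis
  have mon_sub: "monomials d \<subseteq> ?S"
    by (simp add: homogeneous_eq_span_monomials cpoly.span_superset)
  have span_E: "cpoly.span E = ?S"
  proof
    show "cpoly.span E \<subseteq> ?S"
      using E(2) B_sub(1) mon_sub unfolding homogeneous_eq_span_monomials
      by (intro cpoly.span_minimal) auto
    show "?S \<subseteq> cpoly.span E"
      using E(4) unfolding homogeneous_eq_span_monomials
      by (intro cpoly.span_minimal) auto
  qed
  have E_card: "finite E" "card E \<le> card (monomials d :: 'v cpoly set)"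
    using cpoly.independent_span_bound[OF _ E(3), of "monomials d"] card_monomials
      cpoly.span_superset[of E] span_E unfolding homogeneous_eq_span_monomials by auto

  obtain ts where ts: "set ts = E - ?B" "distinct ts"
    using finite_distinct_list[of "E - ?B"] E_card(1) by auto
  have ts_card: "length ts + card J = card E"
    using ts E(1) E_card(1) B(1) distinct_card[OF ts(2)]
    by (metis card_Diff_subset card_image card_mono fin finite_imageI le_add_diff_inverse2)

  have cls_span: "?cls ` cpoly.span (set ts) = ?cls ` ?S"
  proof
    show "?cls ` cpoly.span (set ts) \<subseteq> ?cls ` ?S"
      using ts(1) cpoly.span_mono[of "set ts" E] span_E by (intro image_mono) auto
    show "?cls ` ?S \<subseteq> ?cls ` cpoly.span (set ts)"
    proof
      fix x assume "x \<in> ?cls ` ?S"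
      then obtain f where f: "x = ?cls f" "f \<in> cpoly.span (set ts \<union> ?B)"
        using span_E ts(1) E(1) by (auto simp: Un_absorb2)
      then obtain g r where gr: "f = g + r" "g \<in> cpoly.span (set ts)" "r \<in> cpoly.span ?B"
        by (auto simp: cpoly.span_Un)
      have "cpoly.subspace I"
        using additive_subgroup.a_closed[OF ideal.axioms(1)[OF I]]
          additive_subgroup.zero_closed[OF ideal.axioms(1)[OF I]] I.I_l_closed
        by (simp add: cpoly.subspace_def scale_cpoly_def)
      then have "r \<in> I"
        using gr(3) cpoly.span_minimal[OF B_sub(2)] by auto
      then have "?cls r = \<zero>\<^bsub>?R Quot I\<^esub>"
        by (simp add: I.a_rcos_const FactRing_simps)
      then have "?cls f = ?cls g"
        using h.hom_add[of g r] h.hom_closed[of g] gr(1) by simp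
      then show "x \<in> ?cls ` cpoly.span (set ts)"
        using f(1) gr(2) by auto
    qed
  qed

  (* Only modulo a proper ideal do the constants still form a field. *)
  have "\<one>\<^bsub>?R Quot I\<^esub> \<noteq> \<zero>\<^bsub>?R Quot I\<^esub>"
    using I.rcos_const_imp_mem[of 1] proper h.hom_one by (auto simp: FactRing_simps)
  then have K: "subfield (?cls ` ?K) (?R Quot I)"
    by (rule h.img_is_subfield(2)[OF constants_subfield])
  have "Q.Span (?cls ` ?K) (map ?cls ts) = ?cls ` ?S"
    using h.Span_hom[of ?K ts] cls_span unfolding Span_constants by (simp del: Q.Span.simps)
  moreover have "set (map ?cls ts) \<subseteq> carrier (?R Quot I)"
    using h.hom_closed by auto
  moreover have "hilbert_function I d = Q.dim (?cls ` ?K) (?cls ` ?S)"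
    unfolding hilbert_function_def
    by (intro arg_cong2[of _ _ _ _ "ring.dim (?R Quot I)"]) auto
  ultimately have "hilbert_function I d \<le> length ts"
    using Q.dim_Span_le_length[OF K, of "map ?cls ts"] by (simp del: Q.Span.simps)
  then show ?thesis
    using ts_card E_card(2) card_monomials(2)[where 'v = 'v and d = d] by linarith
qed

section \<open>Ideals of double structures\<close>

lemma cpoly_idealI:
  fixes I :: "'v cpoly set"
  assumes "0 \<in> I" "\<And>f g. f \<in> I \<Longrightarrow> g \<in> I \<Longrightarrow> f + g \<in> I" "\<And>f g. g \<in> I \<Longrightarrow> f * g \<in> I"
  shows "ideal I cpoly_ring"
proof (rule idealI)
  interpret R: cring "cpoly_ring :: 'v cpoly ring"
    by (rule cring_from_type_algebra)
  show "ring (cpoly_ring :: 'v cpoly ring)"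
    by (rule R.ring_axioms)
  show "subgroup I (add_monoid cpoly_ring)"
  proof (rule group.subgroupI[OF R.add.is_group])
    fix f assume "f \<in> I"
    moreover have "inv\<^bsub>add_monoid cpoly_ring\<^esub> f = (- 1) * f"
    proof -
      have "\<ominus>\<^bsub>cpoly_ring\<^esub> f = - f"
        using R.minus_equality[of "- f" f] by simp
      then show ?thesis
        by (simp only: a_inv_def mult_minus1)
    qed
    ultimately show "inv\<^bsub>add_monoid cpoly_ring\<^esub> f \<in> I"
      using assms(3) by metis
  qed (use assms in auto)
qed (use assms(3) in \<open>auto simp: mult.commute\<close>)

lemma ideal_vanishing_ideal: "ideal (vanishing_ideal L) cpoly_ring"
  by (rule cpoly_idealI) (auto simp: vanishing_ideal_def eval_cpoly_add eval_cpoly_mult)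

lemma ideal_double_scheme_ideal:
  "ideal (double_scheme_ideal \<Lambda> P) (cpoly_ring :: 'n::finite cpoly ring)"
proof -
  interpret R: ring "cpoly_ring :: 'n cpoly ring"
    by (rule ring_from_type_algebra)
  show ?thesis
    unfolding double_scheme_ideal_def square_ideal_def
    by (intro R.i_intersect R.i_Intersect)
      (auto intro: R.ideal_prod_is_ideal ideal_vanishing_ideal)
qed

lemma one_notin_double_scheme_ideal:
  assumes "0 \<in> \<Lambda>"
  shows "1 \<notin> double_scheme_ideal \<Lambda> P"
proof -
  interpret R: ring "cpoly_ring :: 'a cpoly ring"
    by (rule ring_from_type_algebra)
  have "1 \<notin> vanishing_ideal \<Lambda>"
    using assms by (auto simp: vanishing_ideal_def)
  then show ?thesis
    using R.ideal_prod_inter[OF ideal_vanishing_ideal ideal_vanishing_ideal, of \<Lambda> \<Lambda>]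
    by (auto simp: double_scheme_ideal_def square_ideal_def)
qed

lemma mult_in_double_scheme_ideal:
  assumes "f \<in> vanishing_ideal \<Lambda>" "g \<in> vanishing_ideal \<Lambda>"
    and "\<And>k. f \<in> vanishing_ideal (P k)" "\<And>k. g \<in> vanishing_ideal (P k)"
  shows "f * g \<in> double_scheme_ideal \<Lambda> P"
  using assms ideal_prod.prod[of f _ g _ cpoly_ring]
  by (simp add: double_scheme_ideal_def square_ideal_def)

section \<open>Quadrics through the points and the linear space\<close>

lemma scalar_product_add_right: "scalar_product c (x + y) = scalar_product c x + scalar_product c y"
  by (simp add: scalar_product_def distrib_left sum.distrib)

lemma scalar_product_scale_right:
  "scalar_product c (a *s x) = a * scalar_product c (x :: complex ^ 'n::finite)"
  by (simp add: scalar_product_def sum_distrib_left mult.left_commute)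

lemma scalar_product_add_left:
  "scalar_product (c + d) x = scalar_product c x + scalar_product d (x :: complex ^ 'n::finite)"
  by (simp add: scalar_product_def distrib_right sum.distrib)

lemma scalar_product_diff_left:
  "scalar_product (c - d) x = scalar_product c x - scalar_product d (x :: complex ^ 'n::finite)"
  by (simp add: scalar_product_def left_diff_distrib sum_subtractf)

lemma scalar_product_scale_left:
  "scalar_product (a *s c) x = a * scalar_product c (x :: complex ^ 'n::finite)"
  by (simp add: scalar_product_def sum_distrib_left mult.assoc)

lemma scalar_product_axis: "scalar_product (axis i 1) x = (x :: complex ^ 'n::finite) $ i"
  by (simp add: scalar_product_def axis_def if_distrib[of "\<lambda>a. a * _"] cong: if_cong)

text \<open>
  Let \<open>m\<close> be a linear form with \<open>m w = 0\<close>. A quadric \<open>\<alpha> m + \<beta> l\<close> contains the linear space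
  \<open>\<alpha> = \<beta> = 0\<close>, and it contains the point \<open>w\<close> because \<open>\<beta> w = 0\<close>. It passes through \<open>v k\<close> if and
  only if \<open>l\<close> takes a certain value there, since \<open>\<beta> (v k) \<noteq> 0\<close>; as the \<open>v k\<close> form a basis, there is
  exactly one such \<open>l\<close>. On the hyperplane \<open>\<beta> = 0\<close> the quadric restricts to \<open>\<alpha> m\<close>. The forms \<open>m\<close>
  that vanish at \<open>w\<close>, taken modulo \<open>\<beta>\<close>, are the linear forms on \<open>{\<beta> = 0} / \<langle>w\<rangle>\<close>, a space of
  dimension two less than the ambient one; choosing coordinates \<open>m r\<close> on it gives the quadrics
  \<open>q r\<close>. Adding a multiple of \<open>w\<close> to a vector changes no \<open>m r\<close> but allows \<open>\<alpha>\<close> to be normalized to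
  \<open>1\<close>, so that the \<open>q r\<close> jointly take all values.
\<close>

lemma exists_quadrics:
  fixes \<alpha> \<beta> w :: "complex ^ 'n::finite" and v :: "'n \<Rightarrow> complex ^ 'n"
  assumes basis: "det (\<chi> i j. v i $ j) \<noteq> 0"
    and w: "scalar_product \<beta> w = 0" "scalar_product \<alpha> w \<noteq> 0"
    and v: "\<And>i. scalar_product \<beta> (v i) \<noteq> 0"
  obtains R :: "'n set" and q :: "'n \<Rightarrow> 'n cpoly"
  where "card R + 2 = CARD('n)"
    and "\<And>r. homogeneous 2 (q r)"
    and "\<And>r x. scalar_product \<alpha> x = 0 \<Longrightarrow> scalar_product \<beta> x = 0 \<Longrightarrow>
      eval_cpoly (q r) (\<lambda>i. x $ i) = 0"
    and "\<And>r a. eval_cpoly (q r) (\<lambda>i. (a *s w) $ i) = 0"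
    and "\<And>r a k. eval_cpoly (q r) (\<lambda>i. (a *s v k) $ i) = 0"
    and "\<And>t. \<exists>x. \<forall>r\<in>R. eval_cpoly (q r) (\<lambda>i. x $ i) = t r"
proof -
  obtain i0 where i0: "w $ i0 \<noteq> 0"
    using w(2) by (metis (no_types, lifting) mult_zero_right scalar_product_def sum.neutral)
  have "\<exists>i1. i1 \<noteq> i0 \<and> \<beta> $ i1 \<noteq> 0"
  proof (rule ccontr)
    assume "\<not> ?thesis"
    then have \<beta>: "\<beta> $ i = 0" if "i \<noteq> i0" for i
      using that by blast
    have sp: "scalar_product \<beta> x = \<beta> $ i0 * x $ i0" for x
      unfolding scalar_product_def using \<beta> by (subst sum.remove[of _ i0]) auto
    then show False
      using w(1) i0 v[of i0] by simp
  qed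
  then obtain i1 where i1: "i1 \<noteq> i0" "\<beta> $ i1 \<noteq> 0"
    by blast
  (* The coordinates other than i0 and i1 parametrize {\<beta> = 0} modulo w: the multiple of w
     can be used to make the coordinate i0 vanish, and then \<beta> = 0 determines the coordinate i1. *)
  define R where "R = UNIV - {i0, i1}"
  define m where "m r = axis r 1 - (w $ r / w $ i0) *s axis i0 1" for r
  have m: "scalar_product (m r) x = x $ r - w $ r / w $ i0 * x $ i0" for r x
    by (simp add: m_def scalar_product_diff_left scalar_product_scale_left scalar_product_axis)
  have "\<exists>l. \<forall>k. scalar_product l (v k) =
      - scalar_product \<alpha> (v k) * scalar_product (m r) (v k) / scalar_product \<beta> (v k)" for r
  proof -
    let ?A = "\<chi> i j. v i $ j"
    obtain B where "?A ** B = mat 1"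
      using basis invertible_det_nz[of ?A] unfolding invertible_def by blast
    then have "surj (\<lambda>l. ?A *v l)"
      using matrix_right_invertible_surjective[of ?A] by blast
    then obtain l where l: "?A *v l = (\<chi> k. - scalar_product \<alpha> (v k) *
        scalar_product (m r) (v k) / scalar_product \<beta> (v k))"
      by (metis surjD)
    have "scalar_product l (v k) = (?A *v l) $ k" for k
      by (simp add: scalar_product_def matrix_vector_mult_def mult.commute)
    then show ?thesis
      unfolding l by auto
  qed
  then obtain l where l: "\<And>r k. scalar_product (l r) (v k) =
      - scalar_product \<alpha> (v k) * scalar_product (m r) (v k) / scalar_product \<beta> (v k)"
    by metis
  define q where "q r = linear_form \<alpha> * linear_form (m r) + linear_form \<beta> * linear_form (l r)" for r
  have q: "eval_cpoly (q r) (\<lambda>i. x $ i) = scalar_product \<alpha> x * scalar_product (m r) x +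
      scalar_product \<beta> x * scalar_product (l r) x" for r x
    by (simp add: q_def eval_cpoly_add eval_cpoly_mult)
  show ?thesis
  proof
    show "card R + 2 = CARD('n)"
      using i1(1) card_Diff_subset[of "{i0, i1}" UNIV] card_mono[of UNIV "{i0, i1}"]
      by (simp add: R_def)
    show "homogeneous 2 (q r)" for r
      using homogeneous_in_mult[OF homogeneous_linear_form homogeneous_linear_form]
      unfolding q_def by (intro homogeneous_in_add) (auto simp: numeral_2_eq_2)
    show "eval_cpoly (q r) (\<lambda>i. x $ i) = 0"
      if "scalar_product \<alpha> x = 0" "scalar_product \<beta> x = 0" for r x
      using that by (simp add: q)
    show "eval_cpoly (q r) (\<lambda>i. (a *s w) $ i) = 0" for r a
      unfolding q using w(1) i0 by (simp add: scalar_product_scale_right m)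
    show "eval_cpoly (q r) (\<lambda>i. (a *s v k) $ i) = 0" for r a k
      unfolding q scalar_product_scale_right using v[of k] by (simp add: l)
    fix t :: "'n \<Rightarrow> complex"
    define x0 where "x0 = (\<chi> j. if j = i0 then 0 else
        if j = i1 then - (\<Sum>r\<in>R. \<beta> $ r * t r) / \<beta> $ i1 else t j)"
    define x where "x = x0 + ((1 - scalar_product \<alpha> x0) / scalar_product \<alpha> w) *s w"
    have "scalar_product \<beta> x0 = (\<Sum>j\<in>insert i0 (insert i1 R). \<beta> $ j * x0 $ j)"
      unfolding scalar_product_def by (rule sum.cong) (auto simp: R_def)
    also have "\<dots> = - (\<Sum>r\<in>R. \<beta> $ r * t r) + (\<Sum>j\<in>R. \<beta> $ j * x0 $ j)"
      using i1 by (simp add: R_def x0_def)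
    also have "(\<Sum>j\<in>R. \<beta> $ j * x0 $ j) = (\<Sum>r\<in>R. \<beta> $ r * t r)"
      by (rule sum.cong) (auto simp: R_def x0_def)
    finally have "scalar_product \<beta> x = 0"
      using w(1) by (simp add: x_def scalar_product_add_right scalar_product_scale_right)
    moreover have "scalar_product \<alpha> x = 1"
      using w(2) by (simp add: x_def scalar_product_add_right scalar_product_scale_right)
    moreover have "scalar_product (m r) x = t r" if "r \<in> R" for r
      using that i0 by (simp add: m x_def x0_def R_def field_simps)
    ultimately have "\<forall>r\<in>R. eval_cpoly (q r) (\<lambda>i. x $ i) = t r"
      by (simp add: q)
    then show "\<exists>x. \<forall>r\<in>R. eval_cpoly (q r) (\<lambda>i. x $ i) = t r"
      by blast
  qed
qed

lemma eval_scale_cpoly: "eval_cpoly (scale_cpoly c f) x = c * eval_cpoly f x"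
  by (simp add: scale_cpoly_def eval_cpoly_mult)

text \<open>
  Since the \<open>q r\<close> jointly take all values, a linear relation between their products says that a
  quadratic form vanishes at every vector \<open>t\<close>. Unit vectors show that its diagonal coefficients
  are zero, and sums of two unit vectors show this for the others. Unordered pairs of indices are
  represented with the larger index first.
\<close>

lemma pairwise_products_independent:
  fixes q :: "nat \<Rightarrow> 'v::finite cpoly" and c :: "nat \<times> nat \<Rightarrow> complex"
  assumes surj: "\<And>t. \<exists>x. \<forall>r<N. eval_cpoly (q r) x = t r"
    and rel: "(\<Sum>p\<in>(SIGMA j:{..<N}. {..j}). scale_cpoly (c p) (q (fst p) * q (snd p))) = 0"
  shows "\<forall>p\<in>(SIGMA j:{..<N}. {..j}). c p = 0"
proof -
  let ?J = "SIGMA j:{..<N}. {..j}"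
  have quadratic: "(\<Sum>p\<in>?J. c p * (t (fst p) * t (snd p))) = 0" for t
  proof -
    obtain x where x: "\<And>r. r < N \<Longrightarrow> eval_cpoly (q r) x = t r"
      using surj by metis
    have "0 = eval_cpoly (\<Sum>p\<in>?J. scale_cpoly (c p) (q (fst p) * q (snd p))) x"
      using rel by simp
    also have "\<dots> = (\<Sum>p\<in>?J. c p * (t (fst p) * t (snd p)))"
      by (auto simp: eval_cpoly_sum eval_scale_cpoly eval_cpoly_mult x intro!: sum.cong)
    finally show ?thesis by simp
  qed
  have diag: "c (a, a) = 0" if "a < N" for a
  proof -
    let ?t = "\<lambda>r. if r = a then 1 else 0 :: complex"
    have "(\<Sum>p\<in>?J. c p * (?t (fst p) * ?t (snd p))) = (\<Sum>p\<in>{(a, a)}. c p * (?t (fst p) * ?t (snd p)))"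
      using that by (intro sum.mono_neutral_right) auto
    then show ?thesis
      using quadratic[of ?t] by simp
  qed
  have off: "c (a, b) = 0" if "a < N" "b < a" for a b
  proof -
    let ?t = "\<lambda>r. if r = a \<or> r = b then 1 else 0 :: complex"
    have "(\<Sum>p\<in>?J. c p * (?t (fst p) * ?t (snd p))) =
        (\<Sum>p\<in>{(a, a), (b, b), (a, b)}. c p * (?t (fst p) * ?t (snd p)))"
      using that by (intro sum.mono_neutral_right) auto
    then show ?thesis
      using quadratic[of ?t] that diag[of a] diag[of b] by simp
  qed
  show ?thesis
    using diag off by (auto simp: le_less)
qed

lemma card_pairs: "2 * card (SIGMA j:{..<N}. {..j}) = N * (N + 1)"
  by (induction N) (simp_all add: card_SigmaI)

text \<open>
  The left-hand side is the number of quartic monomials, and \<open>J\<close>, the number of independent quartics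
  in the ideal, makes the difference to one less than the expected number of conditions.
\<close>

lemma binomial_count:
  assumes "2 * J = n * (n - 1)"
  shows "(n + 4 choose 4) =
    (n + 2) * (n + 1) + (n + 2 choose 4) + 2 * (n + 1 choose 3) - 1 + J"
proof -
  have J: "J = n choose 2" and n2: "n * n = 2 * (n choose 2) + n"
    using assms by (simp_all add: choose_two) (cases n; simp)
  have "(n + 4 choose 4) + 1 = (n + 2) * (n + 1) + (n + 2 choose 4) + 2 * (n + 1 choose 3) + J"
    unfolding J using n2 by (simp add: numeral_eq_Suc)
  then show ?thesis
    by simp
qed

lemma hilbert_function_double_scheme_le:
  fixes \<alpha> \<beta> w :: "complex ^ 'n::finite" and v :: "'n \<Rightarrow> complex ^ 'n"
    and P :: "'p::finite \<Rightarrow> (complex ^ 'n) set"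
  assumes n: "CARD('n) = n + 1"
    and basis: "det (\<chi> i j. v i $ j) \<noteq> 0"
    and w: "scalar_product \<beta> w = 0" "scalar_product \<alpha> w \<noteq> 0"
    and v: "\<And>i. scalar_product \<beta> (v i) \<noteq> 0"
    and \<Lambda>: "0 \<in> \<Lambda>" "\<And>x. x \<in> \<Lambda> \<Longrightarrow> scalar_product \<alpha> x = 0 \<and> scalar_product \<beta> x = 0"
    and P: "\<And>k x. x \<in> P k \<Longrightarrow> (\<exists>a. x = a *s w) \<or> (\<exists>a i. x = a *s v i)"
  shows "hilbert_function (double_scheme_ideal \<Lambda> P) 4 \<le>
    (n + 2) * (n + 1) + (n + 2 choose 4) + 2 * (n + 1 choose 3) - 1"
proof -
  obtain R :: "'n set" and q :: "'n \<Rightarrow> 'n cpoly" where R: "card R + 2 = CARD('n)"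
    and q2: "\<And>r. homogeneous 2 (q r)"
    and q\<Lambda>: "\<And>r x. scalar_product \<alpha> x = 0 \<Longrightarrow> scalar_product \<beta> x = 0 \<Longrightarrow>
      eval_cpoly (q r) (\<lambda>i. x $ i) = 0"
    and qw: "\<And>r a. eval_cpoly (q r) (\<lambda>i. (a *s w) $ i) = 0"
    and qv: "\<And>r a k. eval_cpoly (q r) (\<lambda>i. (a *s v k) $ i) = 0"
    and qR: "\<And>t. \<exists>x. \<forall>r\<in>R. eval_cpoly (q r) (\<lambda>i. x $ i) = t r"
    using exists_quadrics[OF basis w v] by metis
  define N where "N = card R"
  obtain e where e: "bij_betw e {..<N} R"
    unfolding N_def using ex_bij_betw_nat_finite[of R] by (auto simp: atLeast0LessThan)
  define J where "J = (SIGMA j:{..<N}. {..j})"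
  have q_in: "q r \<in> vanishing_ideal \<Lambda>" "q r \<in> vanishing_ideal (P k)" for r k
    using \<Lambda>(2) q\<Lambda> P qw qv unfolding vanishing_ideal_def by (blast, fastforce)
  have surj: "\<exists>x. \<forall>r<N. eval_cpoly (q (e r)) x = t r" for t
  proof -
    obtain x where x: "\<And>r. r \<in> R \<Longrightarrow> eval_cpoly (q r) (\<lambda>i. x $ i) = t (inv_into {..<N} e r)"
      using qR[of "\<lambda>r. t (inv_into {..<N} e r)"] by blast
    then have "eval_cpoly (q (e r)) (\<lambda>i. x $ i) = t r" if "r < N" for r
      using that e by (metis bij_betw_apply bij_betw_inv_into_left lessThan_iff)
    then show ?thesis by blast
  qed
  have "hilbert_function (double_scheme_ideal \<Lambda> P) 4 + card J \<le> (CARD('n) + 4 - 1) choose 4"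
  proof (rule hilbert_function_le[where b = "\<lambda>p. q (e (fst p)) * q (e (snd p))"])
    show "ideal (double_scheme_ideal \<Lambda> P) cpoly_ring"
      by (rule ideal_double_scheme_ideal)
    show "1 \<notin> double_scheme_ideal \<Lambda> P"
      using \<Lambda>(1) by (rule one_notin_double_scheme_ideal)
    show "finite J"
      by (simp add: J_def)
    show "q (e (fst p)) * q (e (snd p)) \<in> double_scheme_ideal \<Lambda> P" for p
      using q_in by (intro mult_in_double_scheme_ideal)
    show "homogeneous 4 (q (e (fst p)) * q (e (snd p)))" for p
      using homogeneous_in_mult[OF q2 q2] by fastforce
    show "\<forall>p\<in>J. c p = 0"
      if "(\<Sum>p\<in>J. scale_cpoly (c p) (q (e (fst p)) * q (e (snd p)))) = 0" for c
      using pairwise_products_independent[of N "\<lambda>r. q (e r)" c] surj that unfolding J_def by blast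
  qed
  moreover have "2 * card J = n * (n - 1)"
  proof -
    have "N = n - 1" "0 < n" using R n N_def by auto
    then show ?thesis
      using card_pairs[of N] by (simp add: J_def mult.commute)
  qed
  ultimately show ?thesis
    using binomial_count[of "card J" n] n by (simp add: add.commute)
qed

section \<open>Points and linear spaces in general position\<close>

text \<open>
  Write \<open>w = v k\<^sub>0\<close>. The determinant says that the remaining points, indexed by \<open>\<sigma>\<close>, form a basis.
  By the Binet-Cauchy identity, the factor with index \<open>i\<close> is
  \<open>\<alpha>(w) \<beta>(v (\<sigma> i)) - \<beta>(w) \<alpha>(v (\<sigma> i))\<close>. It is nonzero if and only if \<open>w\<close> lies on just one
  hyperplane of the pencil spanned by \<open>\<alpha>\<close> and \<open>\<beta>\<close>, and \<open>v (\<sigma> i)\<close> does not lie on this hyperplane.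
\<close>

definition position_poly :: "('n \<Rightarrow> 'p) \<Rightarrow> 'p \<Rightarrow> ('n::finite, 'p::finite) config_coord cpoly" where
  "position_poly \<sigma> k\<^sub>0 = det (\<chi> i j. var (Inr (\<sigma> i, j))) *
    (\<Prod>i\<in>UNIV. \<Sum>a\<in>UNIV. \<Sum>b\<in>UNIV. var (Inl (a, b)) * var (Inr (k\<^sub>0, a)) * var (Inr (\<sigma> i, b)))"

lemma eval_position_poly:
  "eval_cpoly (position_poly \<sigma> k\<^sub>0) (config_coords \<alpha> \<beta> v) =
    det (\<chi> i j. v (\<sigma> i) $ j) * (\<Prod>i\<in>UNIV.
      scalar_product \<alpha> (v k\<^sub>0) * scalar_product \<beta> (v (\<sigma> i)) -
      scalar_product \<beta> (v k\<^sub>0) * scalar_product \<alpha> (v (\<sigma> i)))"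
proof -
  have "(\<Sum>a\<in>UNIV. \<Sum>b\<in>UNIV. (\<alpha> $ a * \<beta> $ b - \<alpha> $ b * \<beta> $ a) * w $ a * u $ b) =
      scalar_product \<alpha> w * scalar_product \<beta> u - scalar_product \<beta> w * scalar_product \<alpha> u" for w u
    unfolding scalar_product_def sum_product sum_subtractf[symmetric]
    by (intro sum.cong refl) (simp add: algebra_simps)
  then show ?thesis
    by (simp add: position_poly_def eval_cpoly_mult eval_cpoly_det eval_cpoly_prod eval_cpoly_sum)
qed

lemma homogeneous_in_det:
  assumes "\<And>i j. homogeneous_in B (d i) (M i j)"
  shows "homogeneous_in B (\<Sum>i\<in>UNIV. d i) (det (\<chi> i j. M i j))"
proof -
  have "homogeneous_in B (0 + (\<Sum>i\<in>UNIV. d i)) (of_int (sign p) * (\<Prod>i\<in>UNIV. M i (p i)))" for p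
    by (intro homogeneous_in_mult homogeneous_in_of_int homogeneous_in_prod assms)
  then show ?thesis
    unfolding det_def by (intro homogeneous_in_sum) simp
qed

lemma multihomogeneous_position_poly: "multihomogeneous (position_poly \<sigma> k\<^sub>0)"
proof -
  (* Each block of coordinates contains either all or none of the Pluecker coordinates, and together
     with a point coordinate it contains all coordinates of this point. *)
  have block: "\<exists>d. homogeneous_in B d (position_poly \<sigma> k\<^sub>0)"
    if pair: "\<And>ab. Inl ab \<in> B \<longleftrightarrow> Q" and point: "\<And>k i. Inr (k, i) \<in> B \<longleftrightarrow> k \<in> K" for B K Q
  proof -
    have l: "homogeneous_in B (of_bool Q) (var (Inl ab))" for ab
      using homogeneous_in_var[of B "Inl ab"] by (cases Q) (simp_all add: pair)
    have r: "homogeneous_in B (of_bool (k \<in> K)) (var (Inr (k, i)))" for k i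
      using homogeneous_in_var[of B "Inr (k, i)"] by (cases "k \<in> K") (simp_all add: point)
    have det: "homogeneous_in B (\<Sum>i\<in>UNIV. of_bool (\<sigma> i \<in> K)) (det (\<chi> i j. var (Inr (\<sigma> i, j))))"
      by (intro homogeneous_in_det r)
    have factor: "homogeneous_in B (of_bool Q + of_bool (k\<^sub>0 \<in> K) + of_bool (\<sigma> i \<in> K))
        (\<Sum>a\<in>UNIV. \<Sum>b\<in>UNIV. var (Inl (a, b)) * var (Inr (k\<^sub>0, a)) * var (Inr (\<sigma> i, b)))" for i
      by (intro homogeneous_in_sum homogeneous_in_mult l r)
    have prod: "homogeneous_in B (\<Sum>i\<in>UNIV. of_bool Q + of_bool (k\<^sub>0 \<in> K) + of_bool (\<sigma> i \<in> K))
        (\<Prod>i\<in>UNIV. \<Sum>a\<in>UNIV. \<Sum>b\<in>UNIV.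
          var (Inl (a, b)) * var (Inr (k\<^sub>0, a)) * var (Inr (\<sigma> i, b)))"
      by (intro homogeneous_in_prod factor)
    show ?thesis
      unfolding position_poly_def by (rule exI) (rule homogeneous_in_mult[OF det prod])
  qed
  show ?thesis
    unfolding multihomogeneous_def
    using block[of "Inl ` UNIV" True "{}"] block[of "Inr ` ({k} \<times> UNIV)" False "{k}" for k] by auto
qed

lemma vec_subspace_dim_one:
  fixes v :: "complex ^ 'n::finite"
  assumes "vec.subspace L" "vec.dim L = 1" "v \<in> L" "v \<noteq> 0" "x \<in> L"
  shows "\<exists>a. x = a *s v"
proof -
  have "vec.dim {v} = vec.dim L"
    using assms by simp
  then have "vec.span {v} = L"
    using vec.dim_eq_span[of "{v}" L] assms by (metis bot_least eq_iff insert_subset vec.span_eq_iff)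
  then show ?thesis
    using assms(5) by (auto simp: vec.span_singleton)
qed

text \<open>
  An example: \<open>\<Lambda>\<close> is given by the vanishing of two coordinates \<open>a\<close> and \<open>b\<close>, the distinguished
  point is the basis vector with index \<open>a\<close>, so that the hyperplane \<open>x $ b = 0\<close> of the pencil
  contains it, and the other points form a basis outside this hyperplane, obtained by adding
  the basis vector with index \<open>b\<close> to the others.
\<close>

lemma exists_in_general_position:
  fixes \<sigma> :: "'n::finite \<Rightarrow> 'p::finite"
  assumes card: "CARD('n) \<ge> 2" and \<sigma>: "inj \<sigma>" "k\<^sub>0 \<notin> range \<sigma>"
  shows "config_space - zero_locus {position_poly \<sigma> k\<^sub>0} \<noteq> {}"
proof -
  have "\<not> CARD('n) \<le> Suc 0"
    using card by simp
  then obtain a b :: 'n where ab: "a \<noteq> b"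
    using card_le_Suc0_iff_eq[of "UNIV :: 'n set"] by auto
  define u :: "'n \<Rightarrow> complex ^ 'n"
    where "u i = (if i = b then axis b 1 else axis i 1 + axis b 1)" for i
  define v where "v k = (if k = k\<^sub>0 then axis a 1 else u (inv_into UNIV \<sigma> k))" for k
  define \<Lambda> where "\<Lambda> = {x :: complex ^ 'n. scalar_product (axis a 1) x = 0 \<and> scalar_product (axis b 1) x = 0}"
  define P where "P k = vec.span {v k}" for k
  have v\<sigma>: "v (\<sigma> i) = u i" for i
    using \<sigma> by (auto simp: v_def)
  have axis_b: "scalar_product (axis b 1) (u i) = 1" for i
    unfolding scalar_product_axis by (simp add: u_def axis_def)
  have at_k0: "scalar_product (axis a 1) (v k\<^sub>0) = 1" "scalar_product (axis b 1) (v k\<^sub>0) = 0"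
    unfolding scalar_product_axis using ab by (simp_all add: v_def axis_def)
  have nonzero: "v k \<noteq> 0" for k
  proof -
    have "u i \<noteq> 0" for i
      using axis_b[of i] by (auto simp: scalar_product_axis)
    then show ?thesis
      by (auto simp: v_def axis_eq_0_iff)
  qed
  have \<Lambda>_eq: "\<Lambda> = {x. \<forall>i. i \<notin> UNIV - {a, b} \<longrightarrow> x $ i = 0}"
    by (auto simp: \<Lambda>_def scalar_product_axis)
  have "vec.dim \<Lambda> = card (UNIV - {a, b})"
    unfolding \<Lambda>_eq by (rule dim_substandard_cart)
  then have "vec.dim \<Lambda> + 2 = CARD('n)"
    using ab card by (simp add: card_Diff_subset)
  moreover have "vec.subspace \<Lambda>"
    by (rule vec.subspaceI) (auto simp: \<Lambda>_def scalar_product_axis)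
  ultimately have "(\<Lambda>, P) \<in> config_space"
    using nonzero by (auto simp: config_space_def codim_two_spaces_def projective_points_def P_def)
  moreover have "eval_cpoly (position_poly \<sigma> k\<^sub>0) (config_coords (axis a 1) (axis b 1) v) \<noteq> 0"
  proof -
    let ?A = "\<chi> i j. u i $ j"
    have "x = 0" if x: "?A *v x = 0" for x
    proof -
      have row: "scalar_product (u i) x = 0" for i
        using arg_cong[OF x, of "\<lambda>y. y $ i"] by (simp add: matrix_vector_mult_def scalar_product_def)
      have xb: "x $ b = 0"
        using row[of b] by (simp add: u_def scalar_product_axis)
      have "x $ i = 0" if "i \<noteq> b" for i
        using row[of i] xb that by (simp add: u_def scalar_product_add_left scalar_product_axis)
      with xb show ?thesis
        by (metis vec_eq_iff zero_index)
    qed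
    then have "invertible ?A"
      using matrix_left_invertible_ker[of ?A] invertible_left_inverse[of ?A] by blast
    then have "det ?A \<noteq> 0"
      using invertible_det_nz by blast
    then show ?thesis
      by (simp add: eval_position_poly v\<sigma> axis_b at_k0)
  qed
  moreover have "v k \<in> P k - {0}" for k
    using nonzero by (simp add: P_def vec.span_base)
  ultimately have "(\<Lambda>, P) \<notin> zero_locus {position_poly \<sigma> k\<^sub>0}"
    unfolding zero_locus_def \<Lambda>_def by blast
  with \<open>(\<Lambda>, P) \<in> config_space\<close> show ?thesis
    by blast
qed

theorem lemma5p1:
  fixes n :: nat
  assumes "n > 2"
    and "CARD('n::finite) = n + 1"
    and "CARD('p::finite) = n + 2"
  shows "\<exists>U :: ('n, 'p) config set. zariski_open U \<and> U \<noteq> {} \<and>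
    (\<forall>(\<Lambda>, P)\<in>U. hilbert_function (double_scheme_ideal \<Lambda> P) 4
       \<le> ((n + 2) * (n + 1) + ((n + 2) choose 4) + 2 * ((n + 1) choose 3)) - 1)"
proof -
  define k\<^sub>0 :: 'p where "k\<^sub>0 = undefined"
  have "card (UNIV :: 'n set) = card (UNIV - {k\<^sub>0})"
    using assms(2,3) by simp
  then obtain \<sigma> where "bij_betw \<sigma> (UNIV :: 'n set) (UNIV - {k\<^sub>0})"
    using finite_same_card_bij[of "UNIV :: 'n set" "UNIV - {k\<^sub>0}"] by auto
  then have \<sigma>: "inj \<sigma>" "range \<sigma> = UNIV - {k\<^sub>0}"
    by (auto simp: bij_betw_def)
  define U :: "('n, 'p) config set" where "U = config_space - zero_locus {position_poly \<sigma> k\<^sub>0}"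
  have "zariski_open U"
    unfolding zariski_open_def U_def using multihomogeneous_position_poly by blast
  moreover have "U \<noteq> {}"
    unfolding U_def using assms(1,2) \<sigma> by (intro exists_in_general_position) auto
  moreover have "hilbert_function (double_scheme_ideal \<Lambda> P) 4 \<le>
      (n + 2) * (n + 1) + (n + 2 choose 4) + 2 * (n + 1 choose 3) - 1" if "(\<Lambda>, P) \<in> U" for \<Lambda> P
  proof -
    have config: "(\<Lambda>, P) \<in> config_space" and "(\<Lambda>, P) \<notin> zero_locus {position_poly \<sigma> k\<^sub>0}"
      using that by (auto simp: U_def)
    then obtain \<alpha> \<beta> v where \<Lambda>: "\<Lambda> = {x. scalar_product \<alpha> x = 0 \<and> scalar_product \<beta> x = 0}"
      and v: "\<And>k. v k \<in> P k - {0}"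
      and nz: "eval_cpoly (position_poly \<sigma> k\<^sub>0) (config_coords \<alpha> \<beta> v) \<noteq> 0"
      unfolding zero_locus_def by blast
    define w where "w = v k\<^sub>0"
    (* \<beta>' is the member of the pencil that vanishes at w. For \<alpha>' any member that does not vanish
       there will do; one of the two generators is such, as otherwise \<beta>' = 0. *)
    define \<beta>' where "\<beta>' = scalar_product \<alpha> w *s \<beta> - scalar_product \<beta> w *s \<alpha>"
    define \<alpha>' where "\<alpha>' = (if scalar_product \<alpha> w \<noteq> 0 then \<alpha> else \<beta>)"
    have \<beta>': "scalar_product \<beta>' x =
        scalar_product \<alpha> w * scalar_product \<beta> x - scalar_product \<beta> w * scalar_product \<alpha> x" for x
      by (simp add: \<beta>'_def scalar_product_diff_left scalar_product_scale_left)
    have basis: "det (\<chi> i j. v (\<sigma> i) $ j) \<noteq> 0" and \<beta>'_v: "scalar_product \<beta>' (v (\<sigma> i)) \<noteq> 0" for i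
      using nz by (auto simp: eval_position_poly \<beta>' w_def)
    have \<alpha>'_w: "scalar_product \<alpha>' w \<noteq> 0"
      using \<beta>'_v[of undefined] by (auto simp: \<alpha>'_def \<beta>')
    show ?thesis
    proof (rule hilbert_function_double_scheme_le[OF assms(2) basis _ \<alpha>'_w \<beta>'_v])
      show "scalar_product \<beta>' w = 0"
        by (simp add: \<beta>')
      show "0 \<in> \<Lambda>"
        by (simp add: \<Lambda> scalar_product_def)
      show "scalar_product \<alpha>' x = 0 \<and> scalar_product \<beta>' x = 0" if "x \<in> \<Lambda>" for x
        using that by (simp add: \<Lambda> \<alpha>'_def \<beta>')
      show "(\<exists>a. x = a *s w) \<or> (\<exists>a i. x = a *s v (\<sigma> i))" if "x \<in> P k" for x k
      proof -
        have "\<exists>a. x = a *s v k"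
          using config v[of k] that
          by (intro vec_subspace_dim_one[of "P k"]) (auto simp: config_space_def projective_points_def)
        moreover have "k = k\<^sub>0 \<or> k \<in> range \<sigma>"
          using \<sigma>(2) by auto
        ultimately show ?thesis
          by (auto simp: w_def)
      qed
    qed
  qed
  ultimately show ?thesis
    by blast
qed
end
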